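(* If $\mathbf{W}$ is a convex body of constant width in $\mathbf{E}^4$, then $I(\mathbf{W})\le 12$. Moreover, if $d\in\{5,6\}$ and $\mathbf{W}$ is a convex body of constant width in $\mathbf{E}^d$, then $I(\mathbf{W})\le 2^d$.
   Context: $\mathbf{E}^d$ is $d$-dimensional Euclidean space. A convex body in $\mathbf{E}^d$ is a compact convex set with non-empty interior. It has constant width if the distance between its two parallel supporting hyperplanes is the same in every direction. Illumination number: a boundary point $p$ of a convex body $\mathbf{K}\subset\mathbf{E}^d$ is illuminated by a direction (nonzero vector) $\mathbf{v}$ if $p+\lambda\mathbf{v}$ lies in the interior of $\mathbf{K}$ for some $\lambda>0$. $I(\mathbf{K})$ is the smallest number of directions such that every boundary point of $\mathbf{K}$ is illuminated by at least one of them. *)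

theory Defs
  imports "HOL-Analysis.Analysis" "HOL-Library.Extended_Nat"
begin

definition convex_body :: "'a::euclidean_space set \<Rightarrow> bool" where
  "convex_body K \<longleftrightarrow> compact K \<and> convex K \<and> interior K \<noteq> {}"

(* The normal u points away from K, so that the two supporting hyperplanes of a
   convex body orthogonal to u have outer normals u and -u. *)
definition supporting_hyperplane :: "'a::euclidean_space set \<Rightarrow> 'a \<Rightarrow> 'a set \<Rightarrow> bool" where
  "supporting_hyperplane K u H \<longleftrightarrow>
     u \<noteq> 0 \<and> (\<exists>b. H = {x. u \<bullet> x = b} \<and> K \<subseteq> {x. u \<bullet> x \<le> b} \<and> K \<inter> H \<noteq> {})"

definition constant_width :: "'a::euclidean_space set \<Rightarrow> bool" where
  "constant_width K \<longleftrightarrow>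
     (\<exists>w. \<forall>u H H'. supporting_hyperplane K u H \<and> supporting_hyperplane K (- u) H' \<longrightarrow>
            setdist H H' = w)"

definition illuminates :: "'a::euclidean_space set \<Rightarrow> 'a \<Rightarrow> 'a \<Rightarrow> bool" where
  "illuminates K v p \<longleftrightarrow> (\<exists>t>0. p + t *\<^sub>R v \<in> interior K)"

(* Valued in enat, so that a set whose boundary no finite family of directions
   illuminates gets the value infinity (the infimum of the empty set) rather than 0. *)
definition illumination_number :: "'a::euclidean_space set \<Rightarrow> enat" where
  "illumination_number K =
     Inf {enat (card D) | D. finite D \<and> 0 \<notin> D \<and> (\<forall>p\<in>frontier K. \<exists>v\<in>D. illuminates K v p)}"

end

theory Submission
  imports Defs
begin

text \<open>
  In a body of constant width $w$ the outer normals $n$, $n'$ at a boundary point $p$ satisfy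
  $|n - n'| \le 1$, because $p - wn$ and $p - wn'$ lie in the body. By a spherical Jung theorem all
  normals at $p$ lie in a cap with centre $c$ and angular radius $\rho$, where
  $\cos\rho = \sqrt{(d+1)/(2d)}$; hence $p$ is illuminated by every direction that forms an angle
  less than $\pi/2 - \rho$ with $-c$. It remains to cover the sphere by few caps of that radius.
  For $d = 5$ take the odd partial sums of the vertices of a centred regular simplex (32 directions),
  for $d = 6$ the signed basis vectors and the even half cube (12 + 32 directions). For $d = 4$ the
  vertices of two regular hexagons in orthogonal planes only give caps of radius exactly
  $\pi/2 - \rho$, and the limiting case is excluded separately.
\<close>

section \<open>Outer normals and illumination\<close>

text \<open>Restricting the normal cone to unit vectors gives a compact subset of the sphere, so its
  convex hull is compact and contains a point of least norm.\<close>

definition outer_normals :: "'a::euclidean_space set \<Rightarrow> 'a \<Rightarrow> 'a set" where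
  "outer_normals K p = {n. norm n = 1 \<and> (\<forall>x\<in>K. n \<bullet> x \<le> n \<bullet> p)}"

lemma compact_outer_normals: "compact (outer_normals K p)"
proof -
  have "outer_normals K p = sphere 0 1 \<inter> (\<Inter>x\<in>K. {n. n \<bullet> x \<le> n \<bullet> p})"
    by (auto simp: outer_normals_def)
  moreover have "closed (\<Inter>x\<in>K. {n. n \<bullet> x \<le> n \<bullet> p})"
    by (intro closed_INT ballI closed_Collect_le continuous_intros)
  ultimately show ?thesis
    by (simp add: compact_Int_closed)
qed

text \<open>If the open ray from \<open>p\<close> along \<open>v\<close> missed the interior, a
  hyperplane would separate the two. Letting \<open>t\<close> tend to 0 shows that this hyperplane
  passes through \<open>p\<close>, so its normal, scaled to length 1, is an outer normal at
  \<open>p\<close> whose inner product with \<open>v\<close> is nonnegative.\<close>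

lemma illuminates_if_inner_neg:
  assumes K: "convex K" "interior K \<noteq> {}" "closed K" and p: "p \<in> K"
    and v: "\<forall>n\<in>outer_normals K p. n \<bullet> v < 0"
  shows "illuminates K v p"
proof (rule ccontr)
  assume not: "\<not> illuminates K v p"
  define R where "R = (\<lambda>t. p + t *\<^sub>R v) ` {0<..}"
  have "R = (+) p ` ((\<lambda>t. t *\<^sub>R v) ` {0<..})"
    by (auto simp: R_def image_image)
  moreover have "convex ((\<lambda>t. t *\<^sub>R v) ` {0<..})"
    by (intro convex_linear_image linear_scale_left) simp_all
  ultimately have "convex R"
    by (simp add: convex_translation)
  moreover have "R \<noteq> {}" "interior K \<inter> R = {}"
    using not by (auto simp: R_def illuminates_def)
  ultimately obtain a b where a: "a \<noteq> 0" and aK: "\<forall>x\<in>interior K. a \<bullet> x \<le> b"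
    and aR: "\<forall>x\<in>R. a \<bullet> x \<ge> b"
    using separating_hyperplane_sets[of "interior K" R] K convex_interior by blast
  have le_b: "a \<bullet> x \<le> b" if "x \<in> K" for x
  proof -
    have "closure (interior K) \<subseteq> {x. a \<bullet> x \<le> b}"
      using aK by (intro closure_minimal closed_halfspace_le) auto
    then show ?thesis
      using that K by (auto simp: convex_closure_interior)
  qed
  have ray: "a \<bullet> p + t * (a \<bullet> v) \<ge> b" if "t > 0" for t
    using aR that by (auto simp: R_def inner_add_right)
  have "((\<lambda>t. a \<bullet> p + t * (a \<bullet> v)) \<longlongrightarrow> a \<bullet> p + 0 * (a \<bullet> v)) (at_right 0)"
    by (intro tendsto_intros)
  then have "a \<bullet> p \<ge> b"
    using ray by (intro tendsto_lowerbound[where F = "at_right (0::real)"])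
      (auto simp: eventually_at_right_less intro: eventually_mono[OF eventually_at_right_less])
  with le_b[OF p] have ab: "a \<bullet> p = b" by simp
  have "a \<bullet> v \<ge> 0"
    using ray[of 1] ab by simp
  moreover have "sgn a \<in> outer_normals K p"
    using a le_b ab by (auto simp: outer_normals_def norm_sgn sgn_div_norm intro!: mult_left_mono)
  ultimately show False
    using v by (fastforce simp: sgn_div_norm mult_less_0_iff)
qed

lemma illumination_number_leI:
  assumes "finite D" "0 \<notin> D" "\<And>p. p \<in> frontier K \<Longrightarrow> \<exists>v\<in>D. illuminates K v p"
  shows "illumination_number K \<le> enat (card D)"
  unfolding illumination_number_def using assms by (intro Inf_lower) blast

section \<open>Normals of bodies of constant width\<close>

lemma supporting_hyperplane_exists:
  assumes "compact K" "K \<noteq> {}" "u \<noteq> 0"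
  obtains b where "supporting_hyperplane K u {x. u \<bullet> x = b}" "\<And>x. x \<in> K \<Longrightarrow> u \<bullet> x \<le> b"
proof -
  have "continuous_on K (\<lambda>x. u \<bullet> x)"
    by (intro continuous_intros)
  then obtain y where "y \<in> K" "\<forall>x\<in>K. u \<bullet> x \<le> u \<bullet> y"
    using continuous_attains_sup[OF assms(1,2)] by blast
  then show ?thesis
    using assms(3) by (intro that[of "u \<bullet> y"]) (auto simp: supporting_hyperplane_def)
qed

text \<open>The point \<open>y\<close> of \<open>K\<close> that is lowest in direction
  \<open>n\<close> lies at distance at most \<open>w\<close> from \<open>p\<close>, since
  \<open>w\<close> bounds the diameter, yet at least \<open>w\<close> below \<open>p\<close> along
  \<open>n\<close>. This forces \<open>y = p - w *\<^sub>R n\<close>. Two such points, for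
  \<open>n\<close> and \<open>n'\<close>, are again at distance at most \<open>w\<close>.\<close>

lemma inner_outer_normals_ge_half:
  fixes K :: "'a::euclidean_space set"
  assumes K: "convex_body K" "constant_width K" and p: "p \<in> K"
    and n: "n \<in> outer_normals K p" "n' \<in> outer_normals K p"
  shows "n \<bullet> n' \<ge> 1/2"
proof -
  from K have comp: "compact K" and int: "interior K \<noteq> {}"
    by (auto simp: convex_body_def)
  then have ne: "K \<noteq> {}" using interior_subset by blast
  obtain w where w: "\<And>u H H'. supporting_hyperplane K u H \<Longrightarrow> supporting_hyperplane K (- u) H'
      \<Longrightarrow> setdist H H' = w"
    using K by (auto simp: constant_width_def)
  \<comment> \<open>The supporting hyperplanes with normals \<open>x - y\<close> and
    \<open>y - x\<close> are at least as far apart as \<open>x\<close> and \<open>y\<close>.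
    Distinct points are required to have a direction; that \<open>w\<close> is positive is derived
    from this bound afterwards.\<close>
  have diam: "dist x y \<le> w" if xy: "x \<in> K" "y \<in> K" "x \<noteq> y" for x y
  proof -
    define u where "u = x - y"
    have u: "u \<noteq> 0" "- u \<noteq> 0" using xy by (auto simp: u_def)
    obtain b where b: "supporting_hyperplane K u {x. u \<bullet> x = b}" "\<And>x. x \<in> K \<Longrightarrow> u \<bullet> x \<le> b"
      using supporting_hyperplane_exists[OF comp ne u(1)] by blast
    obtain b' where b': "supporting_hyperplane K (-u) {x. (-u) \<bullet> x = b'}"
      "\<And>x. x \<in> K \<Longrightarrow> (-u) \<bullet> x \<le> b'"
      using supporting_hyperplane_exists[OF comp ne u(2)] by blast
    have "norm u \<le> dist z z'" if z: "u \<bullet> z = b" "(-u) \<bullet> z' = b'" for z z'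
    proof -
      have "(norm u)\<^sup>2 = u \<bullet> x + (-u) \<bullet> y"
        by (simp add: u_def power2_norm_eq_inner inner_diff)
      also have "\<dots> \<le> u \<bullet> (z - z')"
        using b(2)[OF xy(1)] b'(2)[OF xy(2)] z by (simp add: inner_diff_right)
      also have "\<dots> \<le> norm u * norm (z - z')"
        by (rule norm_cauchy_schwarz)
      finally show ?thesis
        using u by (simp add: power2_eq_square dist_norm)
    qed
    then have "norm u \<le> setdist {x. u \<bullet> x = b} {x. (-u) \<bullet> x = b'}"
      using b(1) b'(1) by (intro le_setdistI) (auto simp: supporting_hyperplane_def)
    with w[OF b(1) b'(1)] show ?thesis
      by (simp add: u_def dist_norm)
  qed
  have wpos: "w > 0"
  proof -
    obtain x e where e: "e > 0" "cball x e \<subseteq> K"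
      using int by (meson ex_in_conv mem_interior_cball)
    obtain k :: 'a where k: "k \<in> Basis" using nonempty_Basis by blast
    have "x \<in> K" "x + e *\<^sub>R k \<in> K" "x \<noteq> x + e *\<^sub>R k"
      using e k by (auto simp: dist_norm subset_iff)
    from diam[OF this] e k show ?thesis by (simp add: dist_norm)
  qed
  have opp: "p - w *\<^sub>R n \<in> K" if n: "n \<in> outer_normals K p" for n
  proof -
    have nn: "norm n = 1" "\<And>x. x \<in> K \<Longrightarrow> n \<bullet> x \<le> n \<bullet> p" and n0: "n \<noteq> 0"
      using n by (auto simp: outer_normals_def)
    have "continuous_on K (\<lambda>x. n \<bullet> x)"
      by (intro continuous_intros)
    then obtain y where y: "y \<in> K" "\<forall>x\<in>K. n \<bullet> y \<le> n \<bullet> x"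
      using continuous_attains_inf[OF comp ne] by blast
    have "supporting_hyperplane K n {x. n \<bullet> x = n \<bullet> p}"
      using n0 nn p by (auto simp: supporting_hyperplane_def)
    moreover have "supporting_hyperplane K (-n) {x. (-n) \<bullet> x = (-n) \<bullet> y}"
      using n0 y by (auto simp: supporting_hyperplane_def)
    ultimately have "w = setdist {x. n \<bullet> x = n \<bullet> p} {x. (-n) \<bullet> x = (-n) \<bullet> y}"
      by (simp add: w)
    \<comment> \<open>The second point is the orthogonal projection of \<open>p\<close> onto the
      hyperplane through \<open>y\<close>.\<close>
    also have "\<dots> \<le> dist p (p - (n \<bullet> (p - y)) *\<^sub>R n)"
      using nn by (intro setdist_le_dist) (auto simp: inner_diff_right norm_eq_1)
    also have "\<dots> = n \<bullet> (p - y)"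
      using nn nn(2)[OF y(1)] by (simp add: dist_norm inner_diff_right)
    finally have 1: "w \<le> n \<bullet> (p - y)" .
    then have "p \<noteq> y" using wpos by auto
    then have 2: "norm (p - y) \<le> w"
      using diam[OF p y(1)] by (simp add: dist_norm)
    have "(norm (p - y - w *\<^sub>R n))\<^sup>2 = (norm (p - y))\<^sup>2 - 2 * w * (n \<bullet> (p - y)) + w\<^sup>2"
      using nn(1) unfolding power2_norm_eq_inner
      by (simp add: inner_diff inner_commute norm_eq_1 power2_eq_square algebra_simps)
    also have "\<dots> \<le> w\<^sup>2 - 2 * w * w + w\<^sup>2"
      using 1 2 wpos by (intro add_mono diff_mono power_mono mult_left_mono) auto
    also have "\<dots> = 0" by (simp add: power2_eq_square)
    finally have "p - y - w *\<^sub>R n = 0" by simp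
    then have "p - w *\<^sub>R n = y" by (simp add: algebra_simps)
    with y show ?thesis by simp
  qed
  show ?thesis
  proof (cases "n = n'")
    case True
    with n show ?thesis by (simp add: outer_normals_def norm_eq_1)
  next
    case False
    have "dist (p - w *\<^sub>R n) (p - w *\<^sub>R n') \<le> w"
      using False wpos by (intro diam opp n) auto
    moreover have "dist (p - w *\<^sub>R n) (p - w *\<^sub>R n') = w * norm (n' - n)"
      using wpos by (simp add: dist_norm flip: scaleR_diff_right)
    ultimately have "norm (n' - n) \<le> 1" using wpos by simp
    then have "(norm (n' - n))\<^sup>2 \<le> 1" by (simp add: power_le_one)
    moreover have "(norm (n' - n))\<^sup>2 = 2 - 2 * (n \<bullet> n')"
      using n by (simp add: outer_normals_def power2_norm_eq_inner inner_diff inner_commute norm_eq_1)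
    ultimately show ?thesis by simp
  qed
qed

section \<open>Spherical Jung theorem\<close>

text \<open>The centre is the direction of the point \<open>q\<close> of least norm in the convex
  hull. Minimality gives \<open>q \<bullet> n \<ge> (norm q)\<^sup>2\<close> on \<open>N\<close>, so
  it suffices to bound \<open>norm q\<close> from below. Write \<open>q\<close> as a convex
  combination of at most d points, d being the dimension. Inner products are 1 on the diagonal and
  at least 1/2 elsewhere, and the squared weights sum to at least 1/d by Cauchy-Schwarz, so the
  squared norm of \<open>q\<close> is at least 1/2 + 1/(2d).\<close>

lemma spherical_Jung_pi_third:
  fixes N :: "'a::euclidean_space set"
  assumes comp: "compact N" and unit: "\<And>n. n \<in> N \<Longrightarrow> norm n = 1"
    and half: "\<And>n n'. n \<in> N \<Longrightarrow> n' \<in> N \<Longrightarrow> n \<bullet> n' \<ge> 1/2"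
  obtains c where "norm c = 1" "\<And>n. n \<in> N \<Longrightarrow> c \<bullet> n \<ge> sqrt ((DIM('a) + 1) / (2 * DIM('a)))"
proof (cases "N = {}")
  case True
  obtain k :: 'a where "k \<in> Basis" using nonempty_Basis by blast
  with True show ?thesis by (intro that[of k]) auto
next
  case False
  let ?d = "real DIM('a)" and ?H = "convex hull N"
  have cH: "compact ?H" "convex ?H" "?H \<noteq> {}"
    using comp False by (auto intro: compact_convex_hull)
  have "continuous_on ?H norm" by (intro continuous_intros)
  then obtain q where q: "q \<in> ?H" "\<forall>x\<in>?H. norm q \<le> norm x"
    using continuous_attains_inf[OF cH(1,3)] by blast
  have qy: "(norm q)\<^sup>2 \<le> q \<bullet> y" if "y \<in> ?H" for y
    using any_closest_point_dot[of ?H q y 0] cH q that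
    by (auto simp: compact_imp_closed inner_diff_right power2_norm_eq_inner)
  \<comment> \<open>The bound 1/2 passes from \<open>N\<close> to its hull in one argument and then
    in the other. Hence 0 is not in the hull, and the hyperplane orthogonal to \<open>q\<close> used
    below is a proper one.\<close>
  have "?H \<subseteq> {y. n \<bullet> y \<ge> 1/2}" if "n \<in> N" for n
    using half that by (intro hull_minimal convex_halfspace_ge) auto
  then have "N \<subseteq> {y. q \<bullet> y \<ge> 1/2}" using q by (auto simp: inner_commute)
  then have "?H \<subseteq> {y. q \<bullet> y \<ge> 1/2}"
    by (intro hull_minimal convex_halfspace_ge)
  then have "q \<bullet> q \<ge> 1/2" using q by auto
  then have q0: "q \<noteq> 0" by auto
  have "?H \<inter> {x. q \<bullet> x = (norm q)\<^sup>2} face_of ?H"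
    using cH qy by (intro face_of_Int_supporting_hyperplane_ge) auto
  then obtain S' where S': "S' \<subseteq> N" "?H \<inter> {x. q \<bullet> x = (norm q)\<^sup>2} = convex hull S'"
    using face_of_convex_hull_subset[OF comp] by blast
  have qS: "q \<in> convex hull S'"
    using q S'(2) by (auto simp: power2_norm_eq_inner)
  have "S' \<subseteq> {x. q \<bullet> x = (norm q)\<^sup>2}"
    using S'(2) hull_subset[of S' convex] by blast
  then have "aff_dim S' \<le> int (DIM('a)) - 1"
    using aff_dim_subset[of S' "{x. q \<bullet> x = (norm q)\<^sup>2}"] q0 by simp
  \<comment> \<open>The minimum norm point lies on a supporting hyperplane, so Caratheodory's theorem needs only
    DIM many points instead of DIM + 1.\<close>
  then obtain S u where S: "finite S" "S \<subseteq> S'" "card S \<le> DIM('a)"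
    and u: "\<forall>x\<in>S. 0 \<le> u x" "sum u S = 1" "(\<Sum>x\<in>S. u x *\<^sub>R x) = q"
    using qS unfolding convex_hull_caratheodory_aff_dim[of S'] mem_Collect_eq by (elim exE conjE) simp
  have "1 \<le> (\<Sum>x\<in>S. (u x)\<^sup>2) * card S"
    using sum_squared_le_sum_of_squares[of u S] u by simp
  also have "\<dots> \<le> (\<Sum>x\<in>S. (u x)\<^sup>2) * ?d"
    using S by (intro mult_left_mono sum_nonneg) auto
  finally have sq: "1 / ?d \<le> (\<Sum>x\<in>S. (u x)\<^sup>2)"
    by (simp add: field_simps)
  have "(norm q)\<^sup>2 = (\<Sum>x\<in>S. \<Sum>y\<in>S. u x * u y * (x \<bullet> y))"
    unfolding power2_norm_eq_inner u(3)[symmetric]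
    by (simp add: inner_sum_left inner_sum_right sum_distrib_left mult.left_commute inner_commute mult.assoc)
  also have "\<dots> \<ge> (\<Sum>x\<in>S. \<Sum>y\<in>S. u x * u y * (1/2 + (if x = y then 1/2 else 0)))"
  proof (intro sum_mono mult_left_mono)
    fix x y assume "x \<in> S" "y \<in> S"
    then have "x \<in> N" "y \<in> N" using S S' by auto
    then show "1/2 + (if x = y then 1/2 else 0) \<le> x \<bullet> y"
      using half unit by (auto simp: norm_eq_1)
  qed (use u in auto)
  also have "(\<Sum>x\<in>S. \<Sum>y\<in>S. u x * u y * (1/2 + (if x = y then 1/2 else 0)))
      = 1/2 * (sum u S * sum u S) + 1/2 * (\<Sum>x\<in>S. (u x)\<^sup>2)"
    using S(1) by (simp add: algebra_simps sum.distrib sum_product sum_distrib_left power2_eq_square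
        if_distrib[of "\<lambda>x. _ * x"] sum.delta' cong: if_cong)
  finally have "(norm q)\<^sup>2 \<ge> 1/2 + 1/2 * (1 / ?d)"
    using sq u(2) by simp
  also have "1/2 + 1/2 * (1 / ?d) = (?d + 1) / (2 * ?d)"
    by (simp add: field_simps)
  finally have nq: "norm q \<ge> sqrt ((?d + 1) / (2 * ?d))"
    by (simp add: real_le_lsqrt)
  have "sgn q \<bullet> n \<ge> sqrt ((?d + 1) / (2 * ?d))" if "n \<in> N" for n
  proof -
    have "(norm q)\<^sup>2 \<le> q \<bullet> n" using qy that by (simp add: hull_inc)
    then have "norm q \<le> sgn q \<bullet> n"
      using q0 by (simp add: sgn_div_norm field_simps power2_eq_square)
    with nq show ?thesis by simp
  qed
  then show ?thesis
    using q0 by (intro that[of "sgn q"]) (auto simp: norm_sgn add.commute)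
qed

section \<open>Complementary caps and the reduction to sphere coverings\<close>

text \<open>Complementary caps around $c$ and $-c$ contain orthogonal unit vectors $n$, $v$ only in
  the extremal position, where $n$, $v$, $c$ are coplanar.\<close>
lemma complementary_caps_rigid:
  fixes n v c :: "'a::real_inner"
  assumes "norm n = 1" "norm v = 1" "norm c = 1" "r\<^sup>2 + R\<^sup>2 = 1" "0 \<le> r" "0 \<le> R"
    and "r \<le> c \<bullet> n" "c \<bullet> v \<le> - R" "0 \<le> n \<bullet> v"
  shows "r *\<^sub>R n = R *\<^sub>R v + c"
proof -
  \<comment> \<open>Here \<open>r\<close> and \<open>R\<close> are cosine and sine of the cap
    radius. Expanding the square of the difference leaves only terms that the hypotheses bound, with
    total at most 0.\<close>
  have "(norm (r *\<^sub>R n - R *\<^sub>R v - c))\<^sup>2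
      = r\<^sup>2 + R\<^sup>2 + 1 - 2 * (r * R * (n \<bullet> v)) - 2 * (r * (c \<bullet> n)) + 2 * (R * (c \<bullet> v))"
    using assms(1-3) unfolding power2_norm_eq_inner
    by (simp add: inner_diff inner_commute norm_eq_1 power2_eq_square algebra_simps)
  also have "\<dots> \<le> r\<^sup>2 + R\<^sup>2 + 1 - 2 * 0 - 2 * (r * r) + 2 * (R * - R)"
    using assms(5-9) by (intro add_mono diff_mono mult_left_mono mult_nonneg_nonneg) auto
  also have "\<dots> = 0"
    using assms(4) by (simp add: power2_eq_square)
  finally show ?thesis by (simp add: algebra_simps)
qed

text \<open>Strictness rules out the extremal position: pairing the rigid identity with
  \<open>c\<close> would give \<open>r * (c \<bullet> n) < 1 - R\<^sup>2 = r\<^sup>2\<close>,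
  against \<open>r \<le> c \<bullet> n\<close>.\<close>

lemma inner_neg_of_complementary_caps:
  fixes n v c :: "'a::real_inner"
  assumes "norm n = 1" "norm c = 1" "r\<^sup>2 + R\<^sup>2 = 1" "0 \<le> r" "0 < R"
    and "r \<le> c \<bullet> n" and v: "c \<bullet> v < - R * norm v"
  shows "n \<bullet> v < 0"
proof (rule ccontr)
  assume neg: "\<not> n \<bullet> v < 0"
  have v0: "v \<noteq> 0" using v by auto
  have cv: "c \<bullet> sgn v < - R"
    using v v0 by (simp add: sgn_div_norm field_simps)
  have "r *\<^sub>R n = R *\<^sub>R sgn v + c"
    using assms cv neg v0
    by (intro complementary_caps_rigid) (auto simp: norm_sgn sgn_div_norm zero_le_divide_iff)
  then have "c \<bullet> (r *\<^sub>R n) = c \<bullet> (R *\<^sub>R sgn v + c)" by simp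
  then have "r * (c \<bullet> n) = R * (c \<bullet> sgn v) + 1"
    using assms(2) by (simp add: inner_add_right norm_eq_1)
  also have "\<dots> < R * (- R) + 1"
    using mult_strict_left_mono[OF cv assms(5)] by simp
  also have "\<dots> = r * r"
    using assms(3) by (simp add: power2_eq_square algebra_simps)
  finally show False
    using assms(4,6) mult_left_mono[of r "c \<bullet> n" r] by simp
qed

lemma constant_width_normals_center:
  fixes K :: "'a::euclidean_space set"
  assumes "convex_body K" "constant_width K" "p \<in> frontier K"
  obtains c where "norm c = 1"
    "\<And>n. n \<in> outer_normals K p \<Longrightarrow> c \<bullet> n \<ge> sqrt ((DIM('a) + 1) / (2 * DIM('a)))"
proof (rule spherical_Jung_pi_third[OF compact_outer_normals])
  have "p \<in> K"
    using assms by (auto simp: convex_body_def frontier_def compact_imp_closed)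
  then show "n \<bullet> n' \<ge> 1/2" if "n \<in> outer_normals K p" "n' \<in> outer_normals K p" for n n'
    using inner_outer_normals_ge_half assms that by blast
qed (use that in \<open>auto simp: outer_normals_def\<close>)

text \<open>The constant is the sine of the Jung radius, whose cosine bounds
  \<open>c \<bullet> n\<close> for the normals \<open>n\<close> at a boundary point. A direction
  \<open>v\<close> chosen for \<open>-c\<close> therefore has negative inner product with all of
  them.\<close>

lemma illumination_number_le_covering:
  fixes K D :: "'a::euclidean_space set"
  assumes K: "convex_body K" "constant_width K" and d: "DIM('a) \<ge> 2" and D: "finite D"
    and cov: "\<And>x. norm x = 1 \<Longrightarrow>
      \<exists>v\<in>D. x \<bullet> v > sqrt ((real DIM('a) - 1) / (2 * DIM('a))) * norm v"
  shows "illumination_number K \<le> enat (card D)"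
proof -
  let ?r = "sqrt ((DIM('a) + 1) / (2 * DIM('a)))" and ?R = "sqrt ((real DIM('a) - 1) / (2 * DIM('a)))"
  \<comment> \<open>Directions must be nonzero. Removing 0 loses nothing, because the strict
    covering inequality fails for \<open>v = 0\<close>.\<close>
  have "illumination_number K \<le> enat (card (D - {0}))"
  proof (rule illumination_number_leI)
    fix p assume p: "p \<in> frontier K"
    obtain c where c: "norm c = 1" "\<And>n. n \<in> outer_normals K p \<Longrightarrow> c \<bullet> n \<ge> ?r"
      using constant_width_normals_center[OF K p] by blast
    obtain v where v: "v \<in> D" "(-c) \<bullet> v > ?R * norm v"
      using cov[of "-c"] c by auto
    have "?r\<^sup>2 + ?R\<^sup>2 = 1" using d by (simp add: field_simps)
    then have "\<forall>n\<in>outer_normals K p. n \<bullet> v < 0"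
      using c v d by (intro ballI inner_neg_of_complementary_caps[of _ c ?r ?R])
        (auto simp: outer_normals_def)
    then have "illuminates K v p"
      using K p by (intro illuminates_if_inner_neg)
        (auto simp: convex_body_def frontier_def compact_imp_closed)
    moreover have "v \<noteq> 0" using v by auto
    ultimately show "\<exists>v\<in>D - {0}. illuminates K v p" using v by blast
  qed (use D in auto)
  also have "\<dots> \<le> enat (card D)"
    using D by (simp add: card_mono)
  finally show ?thesis .
qed

section \<open>Dimension four: two orthogonal hexagons\<close>

text \<open>For orthonormal \<open>e\<close> and \<open>f\<close> the vertices stand at multiples of
  60 degrees. Listing them bounds the cardinality by the length of the list, without a proof of
  distinctness.\<close>

definition hexagon :: "'a::real_vector \<Rightarrow> 'a \<Rightarrow> 'a set" where
  "hexagon e f = set [e, - e,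
     (1/2) *\<^sub>R e + (sqrt 3/2) *\<^sub>R f, (1/2) *\<^sub>R e - (sqrt 3/2) *\<^sub>R f,
     - (1/2) *\<^sub>R e + (sqrt 3/2) *\<^sub>R f, - (1/2) *\<^sub>R e - (sqrt 3/2) *\<^sub>R f]"

lemma finite_hexagon: "finite (hexagon e f)"
  by (simp add: hexagon_def)

lemma card_hexagon_le: "card (hexagon e f) \<le> 6"
  unfolding hexagon_def by (rule order_trans[OF card_length]) simp

lemma norm_hexagon:
  fixes e f :: "'a::real_inner"
  assumes "v \<in> hexagon e f" "norm e = 1" "norm f = 1" "e \<bullet> f = 0"
  shows "norm v = 1"
  using assms by (auto simp: hexagon_def norm_eq_1 inner_add inner_diff inner_commute[of f e])

text \<open>For orthonormal \<open>e\<close> and \<open>f\<close>, some vertex is within 30 degrees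
  of the projection of \<open>x\<close> to their plane; 3/4 is the squared cosine of 30
  degrees.\<close>

lemma inner_hexagon_ge:
  fixes e f x :: "'a::real_inner"
  shows "\<exists>v\<in>hexagon e f. x \<bullet> v \<ge> sqrt (3/4 * ((x \<bullet> e)\<^sup>2 + (x \<bullet> f)\<^sup>2))"
proof -
  define p q s where "p = x \<bullet> e" and "q = x \<bullet> f" and "s = sqrt (3::real)"
  have s: "s * s = 3" "s > 0" by (auto simp: s_def)
  show ?thesis
  \<comment> \<open>In the sectors around \<open>e\<close> and \<open>- e\<close> one of these two
    is nearest. Elsewhere the slanted vertex with the signs of \<open>p\<close> and \<open>q\<close>
    serves.\<close>
  proof (cases "s * \<bar>q\<bar> \<le> \<bar>p\<bar>")
    case True
    then have "(s * \<bar>q\<bar>)\<^sup>2 \<le> \<bar>p\<bar>\<^sup>2"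
      using s by (intro power_mono) auto
    then have "3 * q\<^sup>2 \<le> p\<^sup>2"
      using s by (simp add: power_mult_distrib) (simp add: power2_eq_square)
    then have "sqrt (3/4 * (p\<^sup>2 + q\<^sup>2)) \<le> \<bar>p\<bar>"
      by (intro real_le_lsqrt) auto
    moreover have "\<exists>v\<in>hexagon e f. x \<bullet> v = \<bar>p\<bar>"
      by (auto simp: hexagon_def p_def abs_if)
    ultimately show ?thesis unfolding p_def q_def by metis
  next
    case False
    have "0 \<le> (s * \<bar>q\<bar> - \<bar>p\<bar>) * \<bar>p\<bar>"
      using False by simp
    then have "\<bar>p\<bar> * \<bar>p\<bar> \<le> s * (\<bar>q\<bar> * \<bar>p\<bar>)"
      by (simp add: algebra_simps)
    then have "3/4 * (p\<^sup>2 + q\<^sup>2) \<le> (\<bar>p\<bar> / 2 + s / 2 * \<bar>q\<bar>)\<^sup>2"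
      using s by (simp add: power2_eq_square algebra_simps)
    then have "sqrt (3/4 * (p\<^sup>2 + q\<^sup>2)) \<le> \<bar>p\<bar> / 2 + s / 2 * \<bar>q\<bar>"
      using s by (intro real_le_lsqrt) auto
    moreover have "\<exists>v\<in>hexagon e f. x \<bullet> v = \<bar>p\<bar> / 2 + s / 2 * \<bar>q\<bar>"
      by (auto simp: hexagon_def p_def q_def s_def abs_if inner_add_right inner_diff_right)
    ultimately show ?thesis unfolding p_def q_def by metis
  qed
qed

text \<open>The squared lengths \<open>P\<close>, \<open>Q\<close> of the projections of
  \<open>c\<close> to the two planes add up to 1. If one exceeds 1/2, its hexagon has a vertex
  strictly inside the required cap, as \<open>3/4 * 1/2 = 3/8\<close> is the squared covering
  cosine. Only \<open>P = Q = 1/2\<close> remains, and there both hexagons are used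
  together.\<close>

lemma illumination_number_constant_width_dim_4:
  fixes K :: "'a::euclidean_space set"
  assumes K: "convex_body K" "constant_width K" and d: "DIM('a) = 4"
  shows "illumination_number K \<le> 12"
proof -
  obtain b :: "nat \<Rightarrow> 'a" where b: "bij_betw b {..<4} Basis"
    using ex_bij_betw_nat_finite[OF finite_Basis] d by (metis atLeast0LessThan)
  have bB: "b i \<in> Basis" if "i < 4" for i
    using b that by (auto simp: bij_betw_def)
  have bb: "b i \<bullet> b j = (if i = j then 1 else 0)" if "i < 4" "j < 4" for i j
    using b that bB by (auto simp: bij_betw_def inner_Basis inj_on_eq_iff)
  have inner4: "x \<bullet> y = (x \<bullet> b 0) * (y \<bullet> b 0) + (x \<bullet> b 1) * (y \<bullet> b 1)
      + (x \<bullet> b 2) * (y \<bullet> b 2) + (x \<bullet> b 3) * (y \<bullet> b 3)" for x y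
  proof -
    have "x \<bullet> y = (\<Sum>k\<in>Basis. (x \<bullet> k) * (y \<bullet> k))" by (rule euclidean_inner)
    also have "\<dots> = (\<Sum>i<4. (x \<bullet> b i) * (y \<bullet> b i))"
      by (rule sum.reindex_bij_betw[OF b, symmetric])
    finally show ?thesis by (simp add: eval_nat_numeral)
  qed
  define A B where "A = hexagon (b 0) (b 1)" and "B = hexagon (b 2) (b 3)"
  have unit: "norm v = 1" if "v \<in> A \<union> B" for v
    using that bb norm_hexagon[of v "b 0" "b 1"] norm_hexagon[of v "b 2" "b 3"]
    by (auto simp: A_def B_def norm_eq_1)
  have orth: "v \<bullet> v' = 0" if "v \<in> A" "v' \<in> B" for v v'
    using that bb by (auto simp: A_def B_def hexagon_def inner_add inner_diff)
  have "illumination_number K \<le> enat (card (A \<union> B))"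
  proof (rule illumination_number_leI)
    show "finite (A \<union> B)" by (simp add: A_def B_def finite_hexagon)
    show "0 \<notin> A \<union> B" using unit by fastforce
    fix p assume p: "p \<in> frontier K"
    obtain c where c: "norm c = 1" "\<And>n. n \<in> outer_normals K p \<Longrightarrow> c \<bullet> n \<ge> sqrt (5/8)"
      using constant_width_normals_center[OF K p] d by auto
    have pK: "p \<in> K"
      using K p by (auto simp: convex_body_def frontier_def compact_imp_closed)
    show "\<exists>v\<in>A \<union> B. illuminates K v p"
    proof (rule ccontr)
      assume no: "\<not> (\<exists>v\<in>A \<union> B. illuminates K v p)"
      have ex: "\<exists>n\<in>outer_normals K p. 0 \<le> n \<bullet> v" if "v \<in> A \<union> B" for v
        using illuminates_if_inner_neg[of K p v] K pK no that
        by (force simp: convex_body_def compact_imp_closed not_less)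
      have le: "(-c) \<bullet> v \<le> sqrt (3/8)" if v: "v \<in> A \<union> B" for v
      proof (rule ccontr)
        assume "\<not> ?thesis"
        moreover obtain n where "n \<in> outer_normals K p" "0 \<le> n \<bullet> v"
          using ex v by blast
        ultimately show False
          using inner_neg_of_complementary_caps[of n c "sqrt (5/8)" "sqrt (3/8)" v] c unit[OF v]
          by (auto simp: outer_normals_def)
      qed
      define P Q where "P = (c \<bullet> b 0)\<^sup>2 + (c \<bullet> b 1)\<^sup>2" and "Q = (c \<bullet> b 2)\<^sup>2 + (c \<bullet> b 3)\<^sup>2"
      obtain v where v: "v \<in> A" "sqrt (3/4 * P) \<le> (-c) \<bullet> v"
        using inner_hexagon_ge[of "b 0" "b 1" "-c"]
        unfolding A_def P_def inner_minus_left power2_minus by blast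
      obtain v' where v': "v' \<in> B" "sqrt (3/4 * Q) \<le> (-c) \<bullet> v'"
        using inner_hexagon_ge[of "b 2" "b 3" "-c"]
        unfolding B_def Q_def inner_minus_left power2_minus by blast
      have "sqrt (3/4 * P) \<le> sqrt (3/8)"
        by (rule order_trans[OF v(2) le]) (use v in simp)
      moreover have "sqrt (3/4 * Q) \<le> sqrt (3/8)"
        by (rule order_trans[OF v'(2) le]) (use v' in simp)
      ultimately have "P \<le> 1/2" "Q \<le> 1/2" by simp_all
      moreover have "P + Q = 1"
        using c(1) inner4[of c c] by (simp add: P_def Q_def norm_eq_1 power2_eq_square)
      ultimately have "P = 1/2" "Q = 1/2" by linarith+
      with v v' have cv: "c \<bullet> v \<le> - sqrt (3/8)" "c \<bullet> v' \<le> - sqrt (3/8)"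
        by simp_all
      obtain n n' where n: "n \<in> outer_normals K p" "0 \<le> n \<bullet> v"
        and n': "n' \<in> outer_normals K p" "0 \<le> n' \<bullet> v'"
        using ex v v' by (metis UnI1 UnI2)
      \<comment> \<open>Both caps are extremal here, which determines the two normals. Their inner
        product is then at most 2/5, contradicting the bound 1/2.\<close>
      have "sqrt (5/8) *\<^sub>R n = sqrt (3/8) *\<^sub>R v + c" "sqrt (5/8) *\<^sub>R n' = sqrt (3/8) *\<^sub>R v' + c"
        using n n' c unit v v' cv
        by (auto intro!: complementary_caps_rigid simp: outer_normals_def)
      then have "(sqrt (5/8) *\<^sub>R n) \<bullet> (sqrt (5/8) *\<^sub>R n')
          = (sqrt (3/8) *\<^sub>R v + c) \<bullet> (sqrt (3/8) *\<^sub>R v' + c)" by simp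
      moreover have "(s *\<^sub>R n) \<bullet> (s *\<^sub>R n') = s * s * (n \<bullet> n')" for s
        by simp
      moreover have "(s *\<^sub>R v + c) \<bullet> (s *\<^sub>R v' + c) = s * (c \<bullet> v) + s * (c \<bullet> v') + 1" for s
        using orth[OF v(1) v'(1)] c(1) by (simp add: inner_add inner_commute norm_eq_1)
      ultimately have "sqrt (5/8) * sqrt (5/8) * (n \<bullet> n')
          = sqrt (3/8) * (c \<bullet> v) + sqrt (3/8) * (c \<bullet> v') + 1" by metis
      also have "\<dots> \<le> sqrt (3/8) * (- sqrt (3/8)) + sqrt (3/8) * (- sqrt (3/8)) + 1"
        using cv by (intro add_mono mult_left_mono) auto
      also have "\<dots> = 1/4" by simp
      finally have "5/8 * (n \<bullet> n') \<le> 1/4" by simp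
      then show False
        using inner_outer_normals_ge_half[OF K pK n(1) n'(1)] by simp
    qed
  qed
  also have "card (A \<union> B) \<le> 12"
    using card_Un_le[of A B] card_hexagon_le[of "b 0" "b 1"] card_hexagon_le[of "b 2" "b 3"]
    by (simp add: A_def B_def)
  finally show ?thesis
    by (simp add: numeral_eq_enat order_trans)
qed

section \<open>Counting by parity, and sorting\<close>

text \<open>Deleting a fixed \<open>i\<close> is injective on subsets of one parity: the parity of
  what is left tells whether \<open>i\<close> was a member.\<close>

lemma card_subsets_parity_le:
  fixes I :: "'b set"
  assumes "finite I" "I \<noteq> {}"
  shows "card {S. S \<subseteq> I \<and> even (card S) = e} \<le> 2 ^ (card I - 1)"
proof -
  obtain i where i: "i \<in> I" using assms by blast
  have "inj_on (\<lambda>S. S - {i}) {S. S \<subseteq> I \<and> even (card S) = e}"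
  proof (rule inj_onI)
    fix S T assume ST: "S \<in> {S. S \<subseteq> I \<and> even (card S) = e}" "T \<in> {S. S \<subseteq> I \<and> even (card S) = e}"
      "S - {i} = T - {i}"
    have "i \<in> U \<longleftrightarrow> even (card (U - {i})) \<noteq> e" if "U \<subseteq> I" "even (card U) = e" for U
    proof (cases "i \<in> U")
      case True
      then have "card U = Suc (card (U - {i}))"
        using card.remove[OF finite_subset[OF that(1) assms(1)]] by blast
      with True that(2) show ?thesis by (metis even_Suc)
    qed (use that in auto)
    then have "i \<in> S \<longleftrightarrow> i \<in> T" using ST by (metis (mono_tags, lifting) mem_Collect_eq)
    with ST(3) show "S = T" by blast
  qed
  then have "card {S. S \<subseteq> I \<and> even (card S) = e} \<le> card (Pow (I - {i}))"
    using assms by (intro card_inj_on_le) auto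
  then show ?thesis using i assms by (simp add: card_Pow)
qed

lemma ex_decreasing_enumeration:
  fixes y :: "'b \<Rightarrow> real"
  assumes "finite I" "card I = m"
  obtains f where "bij_betw f {..<m} I" "\<And>i j. i \<le> j \<Longrightarrow> j < m \<Longrightarrow> y (f j) \<le> y (f i)"
proof -
  obtain xs where xs: "set xs = I" "distinct xs"
    using assms finite_distinct_list by blast
  define zs where "zs = sort_key (\<lambda>i. - y i) xs"
  have zs: "set zs = I" "distinct zs" "length zs = m"
    using xs assms by (auto simp: zs_def distinct_card)
  have "sorted (map (\<lambda>i. - y i) zs)" by (simp add: zs_def)
  then have "y (zs ! j) \<le> y (zs ! i)" if "i \<le> j" "j < m" for i j
    using sorted_nth_mono[of _ i j] that zs by fastforce
  moreover have "bij_betw (\<lambda>i. zs ! i) {..<m} I"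
    using zs bij_betw_nth by blast
  ultimately show ?thesis using that by blast
qed


section \<open>Numerical inequalities for dimensions five and six\<close>

text \<open>The constants $29/50$ and $39/50$ are upper bounds for $\sqrt{1/3}$ and $\sqrt{3/5}$, that is,
  for the covering cosine $\sqrt{2/5}$ times the lengths of the directions used for $d = 5$.\<close>
lemma sum_squares_zero_sum_lt_1_nonpos:
  fixes y0 y1 y2 y3 y4 y5 :: real
  assumes "y0 \<ge> y1" "y1 \<ge> y2" "y2 \<ge> y3" "y3 \<ge> y4" "y4 \<ge> y5" "y0 + y1 + y2 + y3 + y4 + y5 = 0"
    and "y0 \<le> 29/50" "- y5 \<le> 29/50" "y0 + y1 + y2 \<le> 39/50" "y2 \<le> 0"
  shows "y0\<^sup>2 + y1\<^sup>2 + y2\<^sup>2 + y3\<^sup>2 + y4\<^sup>2 + y5\<^sup>2 < 1"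
proof -
  define S p where "S = y0 + y1" and "p = - y2"
  \<comment> \<open>By the zero sum, \<open>S\<close> is a sum of four numbers each at least
    \<open>p\<close>, hence \<open>4 * p \<le> S\<close>. Together with
    \<open>S - p \<le> 39/50\<close> this gives \<open>S \<le> 26/25\<close>.\<close>
  have S: "0 \<le> S" "S \<le> 4/3 * (39/50)" "0 \<le> p" "S \<le> 39/50 + p" "4 * p \<le> S"
    using assms by (auto simp: S_def p_def)
  have "0 \<le> (29/50 - y0) * (29/50 - y1)"
    using assms by (intro mult_nonneg_nonneg) auto
  then have top: "y0\<^sup>2 + y1\<^sup>2 \<le> S\<^sup>2 - 29/25 * S + 2 * (29/50)\<^sup>2"
    by (simp add: S_def power2_eq_square algebra_simps)
  have chord: "z\<^sup>2 \<le> (29/50 + p) * (- z) - 29/50 * p" if "p \<le> - z" "- z \<le> 29/50" for z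
    using mult_nonneg_nonneg[of "- z - p" "29/50 + z"] that
    by (simp add: power2_eq_square algebra_simps)
  have "y2\<^sup>2 + y3\<^sup>2 + y4\<^sup>2 + y5\<^sup>2
      \<le> ((29/50 + p) * (- y2) - 29/50 * p) + ((29/50 + p) * (- y3) - 29/50 * p)
        + ((29/50 + p) * (- y4) - 29/50 * p) + ((29/50 + p) * (- y5) - 29/50 * p)"
    using assms by (intro add_mono chord) (auto simp: p_def)
  also have "\<dots> = (29/50 + p) * (- y2 - y3 - y4 - y5) - 4 * (29/50 * p)"
    by (simp add: algebra_simps)
  also have "- y2 - y3 - y4 - y5 = S" using assms by (simp add: S_def)
  finally have tot: "y0\<^sup>2 + y1\<^sup>2 + y2\<^sup>2 + y3\<^sup>2 + y4\<^sup>2 + y5\<^sup>2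
      \<le> S\<^sup>2 - 29/50 * S + 2 * (29/50)\<^sup>2 - p * (58/25 - S)"
    using top by (simp add: algebra_simps)
  show ?thesis
  proof (cases "S \<le> 39/50")
    case True
    have "0 \<le> S * (39/50 - S)" "0 \<le> p * (58/25 - S)"
      using True S by (auto intro!: mult_nonneg_nonneg)
    moreover have "S * (39/50 - S) = 39/50 * S - S\<^sup>2"
      by (simp add: power2_eq_square algebra_simps)
    ultimately have "y0\<^sup>2 + y1\<^sup>2 + y2\<^sup>2 + y3\<^sup>2 + y4\<^sup>2 + y5\<^sup>2 \<le> 1/5 * S + 2 * (29/50)\<^sup>2"
      using tot by linarith
    then show ?thesis using True by (simp add: power2_eq_square)
  next
    case False
    have "0 \<le> (S - 39/50) * (26/25 - S)" "0 \<le> (p - (S - 39/50)) * (58/25 - S)"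
      using False S by (auto intro!: mult_nonneg_nonneg)
    moreover have "(S - 39/50) * (26/25 - S) = 91/50 * S - S\<^sup>2 - 507/625"
      "(p - (S - 39/50)) * (58/25 - S) = p * (58/25 - S) - 31/10 * S + S\<^sup>2 + 1131/625"
      by (simp_all add: power2_eq_square field_simps)
    ultimately have "y0\<^sup>2 + y1\<^sup>2 + y2\<^sup>2 + y3\<^sup>2 + y4\<^sup>2 + y5\<^sup>2
        \<le> 2 * (29/50)\<^sup>2 + 1131/625 - 1014/625 - 1/25 * S"
      using tot by linarith
    then show ?thesis using False by (simp add: power2_eq_square)
  qed
qed

text \<open>The cases \<open>y2 \<le> 0\<close> and \<open>y3 \<ge> 0\<close> are exchanged by
  negating and reversing the sequence. Otherwise the absolute values sum to
  \<open>2 * (y0 + y1 + y2)\<close>, at most 39/25, and the sum of squares is at most 29/50 times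
  that.\<close>

lemma sum_squares_zero_sum_lt_1:
  fixes y0 y1 y2 y3 y4 y5 :: real
  assumes y: "y0 \<ge> y1" "y1 \<ge> y2" "y2 \<ge> y3" "y3 \<ge> y4" "y4 \<ge> y5" "y0 + y1 + y2 + y3 + y4 + y5 = 0"
    and le: "y0 \<le> 29/50" "- y5 \<le> 29/50" "y0 + y1 + y2 \<le> 39/50"
  shows "y0\<^sup>2 + y1\<^sup>2 + y2\<^sup>2 + y3\<^sup>2 + y4\<^sup>2 + y5\<^sup>2 < 1"
proof -
  consider "y2 \<le> 0" | "y3 \<ge> 0" | "y2 \<ge> 0" "y3 \<le> 0" by linarith
  then show ?thesis
  proof cases
    case 1
    with assms show ?thesis by (intro sum_squares_zero_sum_lt_1_nonpos) auto
  next
    case 2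
    have "(- y5)\<^sup>2 + (- y4)\<^sup>2 + (- y3)\<^sup>2 + (- y2)\<^sup>2 + (- y1)\<^sup>2 + (- y0)\<^sup>2 < 1"
      using assms 2 by (intro sum_squares_zero_sum_lt_1_nonpos) auto
    then show ?thesis by simp
  next
    case 3
    have chord: "z\<^sup>2 \<le> 29/50 * \<bar>z\<bar>" if "\<bar>z\<bar> \<le> 29/50" for z :: real
      using mult_right_mono[OF that, of "\<bar>z\<bar>"] by (simp add: power2_eq_square)
    show ?thesis
      using chord[of y0] chord[of y1] chord[of y2] chord[of y3] chord[of y4] chord[of y5] 3 assms
      by (simp add: abs_of_nonneg abs_of_nonpos)
  qed
qed

text \<open>Similarly, $13/20$ and $159/100$ bound $\sqrt{5/12}$ and $\sqrt{5/12}\,\sqrt{6}$ for $d = 6$.\<close>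
lemma sum_squares_half_cube_lt_1:
  fixes a0 a1 a2 a3 a4 a5 :: real
  assumes a: "a0 \<le> 13/20" "a1 \<le> a0" "a2 \<le> a1" "a3 \<le> a2" "a4 \<le> a3" "a5 \<le> a4" "0 \<le> a5"
    and s: "a0 + a1 + a2 + a3 + a4 - a5 \<le> 159/100"
  shows "a0\<^sup>2 + a1\<^sup>2 + a2\<^sup>2 + a3\<^sup>2 + a4\<^sup>2 + a5\<^sup>2 < 1"
\<comment> \<open>The chord of the square over \<open>[a5, 13/20]\<close> alone would give
  2067/2000, more than 1, at \<open>a5 = 0\<close>. Near 0 the square is therefore bounded by lines
  adapted to the midpoint 13/40.\<close>
proof (cases "a5 \<le> 1/25")
  case True
  have "a5\<^sup>2 \<le> (1/25)\<^sup>2" using True a by (intro power_mono) auto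
  then have a5: "a5\<^sup>2 \<le> 1/625" by (simp add: power2_eq_square)
  have sum: "a0 + a1 + a2 + a3 + a4 \<le> 163/100"
    using s True by linarith
  have low: "z\<^sup>2 \<le> c * z" if "0 \<le> z" "z \<le> c" for z c :: real
    using mult_left_mono[OF that(2,1)] by (simp add: power2_eq_square mult.commute)
  show ?thesis
  \<comment> \<open>In each case the five linear bounds share one slope, 13/40 or 39/40, so that
    only the sum of the five numbers enters.\<close>
  proof (cases "a2 \<le> 13/40")
    case True
    have "z\<^sup>2 \<le> 13/40 * z + 169/800" if "0 \<le> z" "z \<le> 13/20" for z :: real
    proof -
      have "0 \<le> (z + 13/40) * (13/20 - z)" using that by (intro mult_nonneg_nonneg) auto
      then show ?thesis by (simp add: power2_eq_square algebra_simps)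
    qed
    then have "a0\<^sup>2 \<le> 13/40 * a0 + 169/800" "a1\<^sup>2 \<le> 13/40 * a1 + 169/800"
      using a by auto
    moreover have "a2\<^sup>2 \<le> 13/40 * a2" "a3\<^sup>2 \<le> 13/40 * a3" "a4\<^sup>2 \<le> 13/40 * a4"
      by (rule low; use True a in linarith)+
    ultimately show ?thesis using a5 sum by linarith
  next
    case False
    have "z\<^sup>2 \<le> 39/40 * z - 169/800" if "13/40 \<le> z" "z \<le> 13/20" for z :: real
    proof -
      have "0 \<le> (z - 13/40) * (13/20 - z)" using that by (intro mult_nonneg_nonneg) auto
      then show ?thesis by (simp add: power2_eq_square algebra_simps)
    qed
    then have "a0\<^sup>2 \<le> 39/40 * a0 - 169/800" "a1\<^sup>2 \<le> 39/40 * a1 - 169/800"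
      "a2\<^sup>2 \<le> 39/40 * a2 - 169/800"
      using a False by auto
    moreover have "a3\<^sup>2 \<le> 39/40 * a3" "a4\<^sup>2 \<le> 39/40 * a4"
      by (rule low; use a in linarith)+
    ultimately show ?thesis using a5 sum by linarith
  qed
next
  case False
  have chord: "z\<^sup>2 \<le> (13/20 + a5) * z - 13/20 * a5" if "a5 \<le> z" "z \<le> 13/20" for z
  proof -
    have "0 \<le> (z - a5) * (13/20 - z)" using that by (intro mult_nonneg_nonneg) auto
    also have "\<dots> = (13/20 + a5) * z - 13/20 * a5 - z\<^sup>2"
      by (simp add: power2_eq_square field_simps)
    finally show ?thesis by simp
  qed
  have "a0\<^sup>2 + a1\<^sup>2 + a2\<^sup>2 + a3\<^sup>2 + a4\<^sup>2
      \<le> ((13/20 + a5) * a0 - 13/20 * a5) + ((13/20 + a5) * a1 - 13/20 * a5)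
        + ((13/20 + a5) * a2 - 13/20 * a5) + ((13/20 + a5) * a3 - 13/20 * a5)
        + ((13/20 + a5) * a4 - 13/20 * a5)"
    using a by (intro add_mono chord) auto
  also have "\<dots> = (13/20 + a5) * (a0 + a1 + a2 + a3 + a4) - 13/4 * a5"
    by (simp add: field_simps)
  also have "\<dots> \<le> (13/20 + a5) * (159/100 + a5) - 13/4 * a5"
    using a s by (intro diff_mono mult_left_mono) auto
  also have "\<dots> = 2067/2000 - 101/100 * a5 + a5\<^sup>2"
    by (simp add: power2_eq_square field_simps)
  finally have "a0\<^sup>2 + a1\<^sup>2 + a2\<^sup>2 + a3\<^sup>2 + a4\<^sup>2 \<le> 2067/2000 - 101/100 * a5 + a5\<^sup>2" .
  \<comment> \<open>The upper limit 2/5 holds because \<open>4 * a5\<close> is at most the left side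
    of \<open>s\<close>.\<close>
  moreover have "0 \<le> (a5 - 1/25) * (2/5 - a5)"
    using False a s by (intro mult_nonneg_nonneg) auto
  moreover have "(a5 - 1/25) * (2/5 - a5) = 11/25 * a5 - 2/125 - a5\<^sup>2"
    by (simp add: power2_eq_square field_simps)
  ultimately show ?thesis using False by linarith
qed

section \<open>Dimension five: odd partial sums of simplex vertices\<close>

text \<open>A unit vector \<open>x\<close> becomes six numbers with sum 0 and square sum 1.
  Uncovered, it would have bounded sums over all odd index sets. Applied to the 1, 3 and 5 largest
  numbers, these bounds contradict the inequality just proved.\<close>

lemma illumination_number_constant_width_dim_5:
  fixes K :: "'a::euclidean_space set"
  assumes K: "convex_body K" "constant_width K" and d: "DIM('a) = 5"
  shows "illumination_number K \<le> 32"
proof -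
  obtain b :: "nat \<Rightarrow> 'a" where b: "bij_betw b {..<5} Basis"
    using ex_bij_betw_nat_finite[OF finite_Basis] d by (metis atLeast0LessThan)
  have bB: "b i \<in> Basis" if "i < 5" for i
    using b that by (auto simp: bij_betw_def)
  have bb: "b i \<bullet> b j = (if i = j then 1 else 0)" if "i < 5" "j < 5" for i j
    using b that bB by (auto simp: bij_betw_def inner_Basis inj_on_eq_iff)
  \<comment> \<open>A root of \<open>5 * \<alpha>\<^sup>2 + 2 * \<alpha> + 1/6 = 0\<close>, the
    condition for the vectors \<open>b i + \<alpha> *\<^sub>R s\<close> to have the inner products
    of simplex vertices.\<close>
  define \<alpha> where "\<alpha> = (sqrt 6 - 6) / 30"
  have \<alpha>: "5 * \<alpha>\<^sup>2 + 2 * \<alpha> = - (1/6)"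
    by (simp add: \<alpha>_def power2_eq_square field_simps)
  define s where "s = (\<Sum>i<5. b i)"
  have bs: "b i \<bullet> s = 1" if "i < 5" for i
    using that by (simp add: s_def inner_sum_right bb)
  have sb: "s \<bullet> b i = 1" if "i < 5" for i
    using bs[OF that] by (simp add: inner_commute)
  have ss: "s \<bullet> s = 5"
    unfolding s_def[THEN arg_cong[of _ _ "\<lambda>z. z \<bullet> s"]] by (simp add: inner_sum_left bs)
  \<comment> \<open>The vertices of a regular simplex centred at the origin, scaled so that
    the coordinates \<^term>\<open>\<lambda>i. x \<bullet> w i\<close> embed the space isometrically into the
    hyperplane of vectors of coordinate sum 0 in six dimensions.\<close>
  define w where "w i = (if i < 5 then b i + \<alpha> *\<^sub>R s else - (sqrt 6 / 6) *\<^sub>R s)" for i :: nat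
  have ww: "w i \<bullet> w j = (if i = j then 1 else 0) - 1/6" if "i < 6" "j < 6" for i j
  proof -
    have 1: "(b i + \<alpha> *\<^sub>R s) \<bullet> (b j + \<alpha> *\<^sub>R s) = b i \<bullet> b j + (5 * \<alpha>\<^sup>2 + 2 * \<alpha>)" if "i < 5" "j < 5"
      using that by (simp add: inner_add bs sb ss power2_eq_square algebra_simps)
    have 2: "sqrt 6 * ((b i + \<alpha> *\<^sub>R s) \<bullet> s) = 1" if "i < 5" for i
      using that by (simp add: inner_add bs ss \<alpha>_def field_simps)
    have 3: "sqrt 6 * (s \<bullet> (b i + \<alpha> *\<^sub>R s)) = 1" if "i < 5" for i
      using 2[OF that] by (simp add: inner_commute)
    show ?thesis
      using that 1 2[of i] 2[of j] 3[of j] bb[of i j] \<alpha> by (auto simp: w_def ss)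
  qed
  have w0: "(\<Sum>i<6. w i) = 0"
  proof -
    have "(\<Sum>i<6. w i) = (\<Sum>i<5. b i + \<alpha> *\<^sub>R s) - (sqrt 6 / 6) *\<^sub>R s"
      by (simp add: eval_nat_numeral w_def)
    also have "\<dots> = (1 + 5 * \<alpha> - sqrt 6 / 6) *\<^sub>R s"
      by (simp add: sum.distrib s_def[symmetric] algebra_simps sum_constant_scaleR)
    also have "\<dots> = 0" by (simp add: \<alpha>_def field_simps)
    finally show ?thesis .
  qed
  have wx: "(\<Sum>i<6. (x \<bullet> w i)\<^sup>2) = x \<bullet> x" for x
  proof -
    have "x \<bullet> x = (\<Sum>k\<in>Basis. (x \<bullet> k) * (x \<bullet> k))" by (rule euclidean_inner)
    also have "\<dots> = (\<Sum>i<5. (x \<bullet> b i)\<^sup>2)"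
      unfolding power2_eq_square by (rule sum.reindex_bij_betw[OF b, symmetric])
    finally have xx: "x \<bullet> x = (\<Sum>i<5. (x \<bullet> b i)\<^sup>2)" .
    have "(\<Sum>i<6. (x \<bullet> w i)\<^sup>2) = (\<Sum>i<5. (x \<bullet> b i + \<alpha> * (x \<bullet> s))\<^sup>2) + 1/6 * (x \<bullet> s)\<^sup>2"
      by (simp add: eval_nat_numeral w_def inner_add_right power_mult_distrib power_divide)
    also have "(\<Sum>i<5. (x \<bullet> b i + \<alpha> * (x \<bullet> s))\<^sup>2)
        = (\<Sum>i<5. (x \<bullet> b i)\<^sup>2) + 2 * \<alpha> * (x \<bullet> s) * (\<Sum>i<5. x \<bullet> b i) + 5 * \<alpha>\<^sup>2 * (x \<bullet> s)\<^sup>2"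
      by (simp add: power2_sum sum.distrib sum_distrib_left power_mult_distrib algebra_simps)
    also have "(\<Sum>i<5. x \<bullet> b i) = x \<bullet> s" by (simp add: s_def inner_sum_right)
    also have "(\<Sum>i<5. (x \<bullet> b i)\<^sup>2) + 2 * \<alpha> * (x \<bullet> s) * (x \<bullet> s) + 5 * \<alpha>\<^sup>2 * (x \<bullet> s)\<^sup>2 + 1/6 * (x \<bullet> s)\<^sup>2
        = (\<Sum>i<5. (x \<bullet> b i)\<^sup>2) + (5 * \<alpha>\<^sup>2 + 2 * \<alpha> + 1/6) * (x \<bullet> s)\<^sup>2"
      by (simp add: power2_eq_square algebra_simps)
    finally show ?thesis using \<alpha> xx by simp
  qed
  define D where "D = (\<lambda>S. \<Sum>i\<in>S. w i) ` {S. S \<subseteq> {..<6} \<and> even (card S) = False}"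
  have fin: "finite {S. S \<subseteq> {..<6::nat} \<and> even (card S) = False}" by simp
  have normw: "norm (\<Sum>i\<in>S. w i) = sqrt (real (card S) - (real (card S))\<^sup>2 / 6)" if "S \<subseteq> {..<6}" for S
  proof -
    have "finite S" using that finite_subset by blast
    have "(\<Sum>i\<in>S. w i) \<bullet> (\<Sum>i\<in>S. w i) = (\<Sum>i\<in>S. \<Sum>j\<in>S. (if i = j then 1 else 0) - 1/6)"
      unfolding inner_sum_left inner_sum_right using that
      by (intro sum.cong refl) (auto simp: ww subset_iff)
    also have "\<dots> = real (card S) - (real (card S))\<^sup>2 / 6"
      using \<open>finite S\<close> by (simp add: sum_subtractf power2_eq_square right_diff_distrib)
    finally show ?thesis by (simp add: norm_eq_sqrt_inner)
  qed
  have "illumination_number K \<le> enat (card D)"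
  proof (rule illumination_number_le_covering[OF K])
    fix x :: 'a assume x: "norm x = 1"
    show "\<exists>v\<in>D. sqrt ((real DIM('a) - 1) / (2 * DIM('a))) * norm v < x \<bullet> v"
    proof (rule ccontr)
      assume "\<not> ?thesis"
      then have le: "x \<bullet> v \<le> sqrt (2/5) * norm v" if "v \<in> D" for v
        using that d by (auto simp: not_less)
      obtain f :: "nat \<Rightarrow> nat" where f: "bij_betw f {..<6} {..<6}"
        "\<And>i j. i \<le> j \<Longrightarrow> j < 6 \<Longrightarrow> x \<bullet> w (f j) \<le> x \<bullet> w (f i)"
        using ex_decreasing_enumeration[of "{..<6::nat}" 6 "\<lambda>i. x \<bullet> w i"] by auto
      have part: "(\<Sum>i<m. x \<bullet> w (f i)) \<le> sqrt (2/5 * (real m - (real m)\<^sup>2 / 6))" if m: "m < 6" "odd m" for m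
      proof -
        have inj: "inj_on f {..<m}"
          using f(1) m by (auto simp: bij_betw_def intro: inj_on_subset)
        have sub: "f ` {..<m} \<subseteq> {..<6}"
          using f(1) m by (auto simp: bij_betw_def)
        have "(\<Sum>i<m. x \<bullet> w (f i)) = x \<bullet> (\<Sum>i\<in>f ` {..<m}. w i)"
          by (simp add: sum.reindex[OF inj] inner_sum_right)
        also have "\<dots> \<le> sqrt (2/5) * norm (\<Sum>i\<in>f ` {..<m}. w i)"
          using sub m inj by (intro le) (auto simp: D_def card_image)
        also have "\<dots> = sqrt (2/5 * (real m - (real m)\<^sup>2 / 6))"
          using sub inj by (simp add: normw card_image flip: real_sqrt_mult)
        finally show ?thesis .
      qed
      define y where "y i = x \<bullet> w (f i)" for i
      have sum6: "(\<Sum>i<6. g (f i)) = (\<Sum>i<6. g i)" for g :: "nat \<Rightarrow> real"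
        by (rule sum.reindex_bij_betw[OF f(1)])
      have "(\<Sum>i<6. y i) = x \<bullet> (\<Sum>i<6. w i)"
        unfolding y_def inner_sum_right by (rule sum6)
      then have y0: "y 0 + y 1 + y 2 + y 3 + y 4 + y 5 = 0"
        unfolding w0 by (simp add: eval_nat_numeral)
      have "(\<Sum>i<6. (y i)\<^sup>2) = x \<bullet> x"
        unfolding y_def wx[symmetric] by (rule sum6)
      then have y1: "(y 0)\<^sup>2 + (y 1)\<^sup>2 + (y 2)\<^sup>2 + (y 3)\<^sup>2 + (y 4)\<^sup>2 + (y 5)\<^sup>2 = 1"
        using x by (simp add: norm_eq_1 eval_nat_numeral)
      \<comment> \<open>The squared norms of the partial sums are 5/6, 3/2 and 5/6, each multiplied
        by 2/5. As the total is 0, the bound for five terms is one for \<open>- y 5\<close>.\<close>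
      have "(\<Sum>i<1. y i) \<le> sqrt (1/3)" "(\<Sum>i<3. y i) \<le> sqrt (3/5)" "(\<Sum>i<5. y i) \<le> sqrt (1/3)"
        using part[of 1] part[of 3] part[of 5] by (simp_all add: y_def power2_eq_square)
      then have "y 0 \<le> sqrt (1/3)" "y 0 + y 1 + y 2 \<le> sqrt (3/5)"
        "y 0 + y 1 + y 2 + y 3 + y 4 \<le> sqrt (1/3)"
        by (simp_all add: eval_nat_numeral)
      moreover have "sqrt (1/3) \<le> 29/50" "sqrt (3/5) \<le> 39/50"
        by (rule real_le_lsqrt; simp add: power2_eq_square)+
      moreover have "y 1 \<le> y 0" "y 2 \<le> y 1" "y 3 \<le> y 2" "y 4 \<le> y 3" "y 5 \<le> y 4"
        using f(2) by (simp_all add: y_def)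
      ultimately have "(y 0)\<^sup>2 + (y 1)\<^sup>2 + (y 2)\<^sup>2 + (y 3)\<^sup>2 + (y 4)\<^sup>2 + (y 5)\<^sup>2 < 1"
        using y0 by (intro sum_squares_zero_sum_lt_1) auto
      with y1 show False by simp
    qed
  qed (use d fin in \<open>auto simp: D_def\<close>)
  also have "card D \<le> 32"
    unfolding D_def using card_image_le[OF fin, of "\<lambda>S. \<Sum>i\<in>S. w i"]
      card_subsets_parity_le[of "{..<6::nat}" False] by (simp add: lessThan_empty_iff)
  finally show ?thesis
    by (simp add: numeral_eq_enat order_trans)
qed

section \<open>Dimension six: cross-polytope and half cube\<close>

text \<open>Uncovered, \<open>x\<close> would have small coordinates, by the signed basis vectors,
  and a small sum of absolute values up to twice the least of them, by the half cube. The sorted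
  absolute values then have square sum below 1.\<close>

lemma illumination_number_constant_width_dim_6:
  fixes K :: "'a::euclidean_space set"
  assumes K: "convex_body K" "constant_width K" and d: "DIM('a) = 6"
  shows "illumination_number K \<le> 64"
proof -
  \<comment> \<open>\<open>V S\<close> is the vertex of the cube with coordinates 1 and -1 whose
    minus signs stand on \<open>S\<close>; \<open>P\<close> selects every second vertex.\<close>
  define V where "V S = (\<Sum>k\<in>Basis. if k \<in> S then - k else k)" for S :: "'a set"
  define P where "P = {S. S \<subseteq> (Basis :: 'a set) \<and> even (card S) = True}"
  define D where "D = Basis \<union> uminus ` Basis \<union> V ` P"
  have finP: "finite P" by (simp add: P_def)
  have xV: "x \<bullet> V S = (\<Sum>k\<in>Basis. if k \<in> S then - (x \<bullet> k) else x \<bullet> k)" for x S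
    by (simp add: V_def inner_sum_right if_distrib[of "(\<bullet>) x"] cong: if_cong)
  have normV: "norm (V S) = sqrt 6" for S
  proof -
    have "V S \<bullet> k = (if k \<in> S then - 1 else 1)" if "k \<in> Basis" for k
    proof -
      have "V S \<bullet> k = (\<Sum>j\<in>Basis. if j = k then (if k \<in> S then - 1 else 1) else 0)"
        unfolding V_def inner_sum_left using that by (intro sum.cong) (auto simp: inner_Basis)
      then show ?thesis using that by simp
    qed
    then have "V S \<bullet> V S = (\<Sum>k\<in>(Basis::'a set). 1)"
      unfolding xV by (intro sum.cong) auto
    then show ?thesis using d by (simp add: norm_eq_sqrt_inner)
  qed
  have "illumination_number K \<le> enat (card D)"
  proof (rule illumination_number_le_covering[OF K])
    fix x :: 'a assume x: "norm x = 1"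
    show "\<exists>v\<in>D. sqrt ((real DIM('a) - 1) / (2 * DIM('a))) * norm v < x \<bullet> v"
    proof (rule ccontr)
      assume "\<not> ?thesis"
      then have le: "x \<bullet> v \<le> sqrt (5/12) * norm v" if "v \<in> D" for v
        using that d by (auto simp: not_less)
      have sq: "sqrt (5/12) \<le> 13/20" "sqrt (5/12) * sqrt 6 \<le> 159/100"
        unfolding real_sqrt_mult[symmetric] by (rule real_le_lsqrt; simp add: power2_eq_square)+
      have coord: "\<bar>x \<bullet> k\<bar> \<le> 13/20" if "k \<in> Basis" for k
        using le[of k] le[of "- k"] that sq(1) by (auto simp: D_def)
      have cube: "x \<bullet> V S \<le> 159/100" if "S \<in> P" for S
        using le[of "V S"] that sq(2) normV[of S] by (auto simp: D_def)
      obtain f :: "nat \<Rightarrow> 'a" where f: "bij_betw f {..<6} Basis"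
        "\<And>i j. i \<le> j \<Longrightarrow> j < 6 \<Longrightarrow> \<bar>x \<bullet> f j\<bar> \<le> \<bar>x \<bullet> f i\<bar>"
        using ex_decreasing_enumeration[of "Basis :: 'a set" 6 "\<lambda>k. \<bar>x \<bullet> k\<bar>"] d by auto
      define a where "a i = \<bar>x \<bullet> f i\<bar>" for i
      have fB: "f i \<in> Basis" if "i < 6" for i
        using f(1) that by (auto simp: bij_betw_def)
      have sum6: "(\<Sum>i<6. g (f i)) = (\<Sum>k\<in>Basis. g k)" for g :: "'a \<Rightarrow> real"
        by (rule sum.reindex_bij_betw[OF f(1)])
      define N where "N = {k\<in>Basis. x \<bullet> k < 0}"
      have xN: "x \<bullet> V N = (\<Sum>k\<in>Basis. \<bar>x \<bullet> k\<bar>)"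
        unfolding xV by (intro sum.cong) (auto simp: N_def)
      \<comment> \<open>If the sign vector of x has the wrong parity, flip the sign of the smallest coordinate.\<close>
      have "(\<Sum>k\<in>Basis. \<bar>x \<bullet> k\<bar>) - 2 * a 5 \<le> 159/100"
      proof (cases "even (card N)")
        case True
        then have "N \<in> P" by (auto simp: P_def N_def)
        from cube[OF this] xN show ?thesis by (simp add: a_def)
      next
        case False
        define M where "M = (if f 5 \<in> N then N - {f 5} else insert (f 5) N)"
        have "finite N" "N \<subseteq> Basis" by (auto simp: N_def)
        then have "M \<in> P" using False fB[of 5] by (auto simp: P_def M_def)
        have "x \<bullet> V M = (\<Sum>k\<in>Basis. \<bar>x \<bullet> k\<bar> - (if k = f 5 then 2 * a 5 else 0))"
          unfolding xV by (intro sum.cong) (auto simp: N_def M_def a_def)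
        also have "\<dots> = (\<Sum>k\<in>Basis. \<bar>x \<bullet> k\<bar>) - 2 * a 5"
          using fB[of 5] by (simp add: sum_subtractf)
        finally show ?thesis using cube[OF \<open>M \<in> P\<close>] by simp
      qed
      then have "(\<Sum>i<6. a i) - 2 * a 5 \<le> 159/100"
        unfolding a_def using sum6[of "\<lambda>k. \<bar>x \<bullet> k\<bar>"] by simp
      then have s: "a 0 + a 1 + a 2 + a 3 + a 4 - a 5 \<le> 159/100"
        by (simp add: eval_nat_numeral)
      have "(\<Sum>i<6. (a i)\<^sup>2) = (\<Sum>k\<in>Basis. (x \<bullet> k)\<^sup>2)"
        unfolding a_def power2_abs by (rule sum6)
      also have "\<dots> = 1"
        using x euclidean_inner[of x x] by (simp add: norm_eq_1 power2_eq_square)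
      finally have one: "(a 0)\<^sup>2 + (a 1)\<^sup>2 + (a 2)\<^sup>2 + (a 3)\<^sup>2 + (a 4)\<^sup>2 + (a 5)\<^sup>2 = 1"
        by (simp add: eval_nat_numeral)
      have "a 1 \<le> a 0" "a 2 \<le> a 1" "a 3 \<le> a 2" "a 4 \<le> a 3" "a 5 \<le> a 4"
        using f(2) by (simp_all add: a_def)
      moreover have "a 0 \<le> 13/20" "0 \<le> a 5"
        using coord[OF fB] by (auto simp: a_def)
      ultimately have "(a 0)\<^sup>2 + (a 1)\<^sup>2 + (a 2)\<^sup>2 + (a 3)\<^sup>2 + (a 4)\<^sup>2 + (a 5)\<^sup>2 < 1"
        using s by (intro sum_squares_half_cube_lt_1) auto
      with one show False by simp
    qed
  qed (use d finP in \<open>auto simp: D_def\<close>)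
  also have "card D \<le> 64"
  proof -
    have "card D \<le> card (Basis :: 'a set) + card (uminus ` (Basis :: 'a set)) + card (V ` P)"
      unfolding D_def by (intro order_trans[OF card_Un_le] add_mono card_Un_le order_refl)
    also have "\<dots> \<le> 6 + 6 + card P"
      using d card_image_le[OF finP, of V] card_image_le[OF finite_Basis, of "uminus :: 'a \<Rightarrow> 'a"] by simp
    also have "card P \<le> 2 ^ 5"
      using card_subsets_parity_le[of "Basis :: 'a set" True] d by (simp add: P_def)
    finally show ?thesis by simp
  qed
  finally show ?thesis
    by (simp add: numeral_eq_enat order_trans)
qed

theorem corollary3p3:
  fixes W :: "'a::euclidean_space set"
  assumes "convex_body W" and "constant_width W"
  shows "(DIM('a) = 4 \<longrightarrow> illumination_number W \<le> 12) \<and>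
         (DIM('a) \<in> {5, 6} \<longrightarrow> illumination_number W \<le> 2 ^ DIM('a))"
  using illumination_number_constant_width_dim_4[OF assms] illumination_number_constant_width_dim_5[OF assms]
    illumination_number_constant_width_dim_6[OF assms] by auto

end
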